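(* Let $\mathcal G=(\mathcal V,\mathcal E)$ be an acyclic graph with source $s$ and sink set $\mathcal T$, carrying an $n$-dimensional network code over $\mathbb F_q$ for the instantaneous network on $\mathcal G$ (so every $M_T$ is invertible over $\mathbb F_q$), used with the same local kernels on the unit-delay, memory-free network on $\mathcal G$. For each sink $T$ let the processing function be $$p_T(z)=\frac{\det M_T(z)}{g_T(z)},$$ where $g_T(z)$ is the greatest common divisor of the entries of the adjoint (adjugate) matrix of $M_T(z)$, and let $P_T(z)=p_T(z)M_T^{-1}(z)$. Then for every sink $T\in\mathcal T$ and every error vector $\boldsymbol w\in\mathbb F_q^{|\mathcal E|}$, $$w_H\left(\boldsymbol wF_TM_T^{-1}\right)\le w_H\left(\boldsymbol wF_T(z)P_T(z)\right).$$ Consequently, for every error pattern set $\Phi$, the free distance $2t_s+1$ demanded of the input convolutional code for the unit-delay network is at least the free distance $2t_{s,inst}+1$ demanded for the corresponding instantaneous network, where $t_s=\max_{T\in\mathcal T,\ \boldsymbol w\in\mathcal W_\Phi}w_H(\boldsymbol wF_T(z)P_T(z))$ and $t_{s,inst}=\max_{T\in\mathcal T,\ \boldsymbol w\in\mathcal W_\Phi}w_H(\boldsymbol wF_TM_T^{-1})$.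
   Context: $\mathcal G$ is a finite acyclic directed multigraph; edges $e_1,\dots,e_{|\mathcal E|}$ are in ancestral order. A network code of dimension $n$ is given by matrices over $\mathbb F_q$: $A$ ($n\times|\mathcal E|$, $A_{i,j}=0$ unless $e_j$ leaves the source $s$), $K$ ($|\mathcal E|\times|\mathcal E|$, $K_{i,j}=0$ unless $e_i$ enters the node that $e_j$ leaves), and for each sink $T$ a matrix $B^{T}$ ($|\mathcal E|\times n$, $B^{T}_{i,j}=0$ unless $e_i$ enters $T$; the superscript denotes the sink). In the unit-delay, memory-free network: $F_T(z)=(I-zK)^{-1}B^{T}$ and the network transfer matrix is $M_T(z)=AF_T(z)$. In the instantaneous network: $F_T=(I-K)^{-1}B^{T}=F_T(z)|_{z=1}$ and $M_T=AF_T=M_T(z)|_{z=1}$. All entries of $F_T(z)$ and $M_T(z)$ are polynomials in $z$. $w_H$ is Hamming weight over $\mathbb F_q$: the number of nonzero entries of a vector over $\mathbb F_q$, and the total number of nonzero coefficients of a vector over $\mathbb F_q[z]$. An error pattern set $\Phi$ is a collection of subsets of $\mathcal E$; $\mathcal W_\Phi$ is the set of $\boldsymbol w\in\mathbb F_q^{|\mathcal E|}$ whose nonzero coordinates all lie on edges of some $\rho\in\Phi$. In the code construction the input convolutional code is required to have free distance at least $2t_s+1$ (unit-delay network), respectively $2t_{s,inst}+1$ (instantaneous network). *)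

theory Defs
  imports
    Graph_Theory.Graph_Theory
    Jordan_Normal_Form.Determinant
    "HOL-Computational_Algebra.Polynomial_Factorial"
begin

section \<open>Matrix inverses, row vectors and Hamming weights\<close>

text \<open>The two-sided inverse over an arbitrary commutative ring. It is used over
  \<open>F\<^sub>q\<close>, over \<open>F\<^sub>q[z]\<close> and over the field of fractions of \<open>F\<^sub>q[z]\<close>.\<close>

definition mat_inv :: "'a::comm_ring_1 mat \<Rightarrow> 'a mat" where
  "mat_inv A = (THE B. B \<in> carrier_mat (dim_row A) (dim_row A) \<and> inverts_mat A B \<and> inverts_mat B A)"

text \<open>The product of a row vector with a matrix.\<close>

definition row_mult :: "'a::comm_semiring_0 vec \<Rightarrow> 'a mat \<Rightarrow> 'a vec" where
  "row_mult w M = vec (dim_col M) (\<lambda>j. w \<bullet> col M j)"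

definition hamming_weight :: "'a::zero vec \<Rightarrow> nat" where
  "hamming_weight v = card {i. i < dim_vec v \<and> v $ i \<noteq> 0}"

definition poly_hamming_weight :: "'a::zero poly vec \<Rightarrow> nat" where
  "poly_hamming_weight v = (\<Sum>i<dim_vec v. card {k. coeff (v $ i) k \<noteq> 0})"

text \<open>Greatest common divisors are determined only up to a unit; all choices are admitted.\<close>

definition is_gcd_of :: "'a::comm_semiring_1 \<Rightarrow> 'a set \<Rightarrow> bool" where
  "is_gcd_of g S \<longleftrightarrow> (\<forall>a\<in>S. g dvd a) \<and> (\<forall>d. (\<forall>a\<in>S. d dvd a) \<longrightarrow> d dvd g)"


section \<open>Network codes\<close>

text \<open>The list \<open>es\<close> enumerates the edges; an edge from whose head one can reach the tail of
  another edge comes strictly before it. Indices start at 0.\<close>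

definition ancestral_order :: "('v, 'e) pre_digraph \<Rightarrow> 'e list \<Rightarrow> bool" where
  "ancestral_order G es \<longleftrightarrow> distinct es \<and> set es = arcs G \<and>
     (\<forall>i<length es. \<forall>j<length es. head G (es ! i) \<rightarrow>\<^sup>*\<^bsub>G\<^esub> tail G (es ! j) \<longrightarrow> i < j)"

locale network_code = fin_digraph G
  for G :: "('v, 'e) pre_digraph" +
  fixes s :: 'v and sinks :: "'v set" and es :: "'e list" and n :: nat
    and A :: "'a::{field,finite} mat" and K :: "'a mat" and B :: "'v \<Rightarrow> 'a mat"
  assumes acyclic_graph: "\<nexists>c. pre_digraph.cycle G c"
    and source: "s \<in> verts G"
    and sinks: "sinks \<subseteq> verts G"
    and edge_order: "ancestral_order G es"
    and A_dim: "A \<in> carrier_mat n (length es)"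
    and A_supp: "\<And>i j. i < n \<Longrightarrow> j < length es \<Longrightarrow> tail G (es ! j) \<noteq> s \<Longrightarrow> A $$ (i, j) = 0"
    and K_dim: "K \<in> carrier_mat (length es) (length es)"
    and K_supp: "\<And>i j. i < length es \<Longrightarrow> j < length es \<Longrightarrow>
        head G (es ! i) \<noteq> tail G (es ! j) \<Longrightarrow> K $$ (i, j) = 0"
    and B_dim: "\<And>T. T \<in> sinks \<Longrightarrow> B T \<in> carrier_mat (length es) n"
    and B_supp: "\<And>T i j. T \<in> sinks \<Longrightarrow> i < length es \<Longrightarrow> j < n \<Longrightarrow>
        head G (es ! i) \<noteq> T \<Longrightarrow> B T $$ (i, j) = 0"

text \<open>The last argument of the following transfer matrices is the matrix \<open>B\<^sup>T\<close> of the sink \<open>T\<close>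
  under consideration; \<open>monom 1 1\<close> is the indeterminate \<open>z\<close>.\<close>

definition F_inst :: "'a::field mat \<Rightarrow> 'a mat \<Rightarrow> 'a mat" where
  "F_inst K BT = mat_inv (1\<^sub>m (dim_row K) - K) * BT"

definition M_inst :: "'a::field mat \<Rightarrow> 'a mat \<Rightarrow> 'a mat \<Rightarrow> 'a mat" where
  "M_inst A K BT = A * F_inst K BT"

definition const_mat :: "'a::zero mat \<Rightarrow> 'a poly mat" where
  "const_mat M = map_mat (\<lambda>a. [:a:]) M"

definition F_delay :: "'a::field mat \<Rightarrow> 'a mat \<Rightarrow> 'a poly mat" where
  "F_delay K BT = mat_inv (1\<^sub>m (dim_row K) - monom 1 1 \<cdot>\<^sub>m const_mat K) * const_mat BT"

definition M_delay :: "'a::field mat \<Rightarrow> 'a mat \<Rightarrow> 'a mat \<Rightarrow> 'a poly mat" where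
  "M_delay A K BT = const_mat A * F_delay K BT"

definition processing_function :: "'a::field poly mat \<Rightarrow> 'a poly \<Rightarrow> 'a poly" where
  "processing_function M g = det M div g"

text \<open>\<open>p(z) M(z)\<^sup>-\<^sup>1\<close>, where \<open>M(z)\<close> is inverted over the rational functions. The product has
  polynomial entries and is taken as a matrix over \<open>F\<^sub>q[z]\<close>, see \<open>processing_matrix\<close> below.\<close>

definition processing_matrix :: "'a::field poly mat \<Rightarrow> 'a poly \<Rightarrow> 'a poly mat" where
  "processing_matrix M g = (THE P. map_mat to_fract P =
     to_fract (processing_function M g) \<cdot>\<^sub>m mat_inv (map_mat to_fract M))"


section \<open>Error vectors and demanded free distances\<close>

definition inst_error_weight :: "'a::field mat \<Rightarrow> 'a mat \<Rightarrow> 'a mat \<Rightarrow> 'a vec \<Rightarrow> nat" where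
  "inst_error_weight A K BT w =
     hamming_weight (row_mult w (F_inst K BT * mat_inv (M_inst A K BT)))"

definition delay_error_weight ::
    "'a::field mat \<Rightarrow> 'a mat \<Rightarrow> 'a mat \<Rightarrow> 'a poly \<Rightarrow> 'a vec \<Rightarrow> nat" where
  "delay_error_weight A K BT g w =
     poly_hamming_weight (row_mult (map_vec (\<lambda>a. [:a:]) w)
       (F_delay K BT * processing_matrix (M_delay A K BT) g))"

definition error_vectors :: "'e list \<Rightarrow> 'e set set \<Rightarrow> 'a::zero vec set" where
  "error_vectors es \<Phi> = {w \<in> carrier_vec (length es).
     \<exists>\<rho>\<in>\<Phi>. \<forall>i<length es. w $ i \<noteq> 0 \<longrightarrow> es ! i \<in> \<rho>}"

definition t_inst :: "'v set \<Rightarrow> 'e list \<Rightarrow> 'a::field mat \<Rightarrow> 'a mat \<Rightarrow> ('v \<Rightarrow> 'a mat) \<Rightarrow>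
    'e set set \<Rightarrow> nat" where
  "t_inst sinks es A K B \<Phi> =
     Max {inst_error_weight A K (B T) w | T w. T \<in> sinks \<and> w \<in> error_vectors es \<Phi>}"

definition t_delay :: "'v set \<Rightarrow> 'e list \<Rightarrow> 'a::field mat \<Rightarrow> 'a mat \<Rightarrow> ('v \<Rightarrow> 'a mat) \<Rightarrow>
    ('v \<Rightarrow> 'a poly) \<Rightarrow> 'e set set \<Rightarrow> nat" where
  "t_delay sinks es A K B g \<Phi> =
     Max {delay_error_weight A K (B T) (g T) w | T w. T \<in> sinks \<and> w \<in> error_vectors es \<Phi>}"

definition demanded_free_distance :: "nat \<Rightarrow> nat" where
  "demanded_free_distance t = 2 * t + 1"


section \<open>The inverses and the processing matrix are well defined\<close>

lemma mat_inv_eqI: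
  fixes A :: "'a::comm_ring_1 mat"
  assumes A: "A \<in> carrier_mat n n" and C: "C \<in> carrier_mat n n"
    and AC: "A * C = 1\<^sub>m n" and CA: "C * A = 1\<^sub>m n"
  shows "mat_inv A = C"
  unfolding mat_inv_def
proof (rule the_equality)
  show "C \<in> carrier_mat (dim_row A) (dim_row A) \<and> inverts_mat A C \<and> inverts_mat C A"
    using assms by (auto simp: inverts_mat_def)
next
  fix D assume D: "D \<in> carrier_mat (dim_row A) (dim_row A) \<and> inverts_mat A D \<and> inverts_mat D A"
  then have Dc: "D \<in> carrier_mat n n" and DA: "D * A = 1\<^sub>m n"
    using A by (auto simp: inverts_mat_def)
  have "D = D * (A * C)" using AC Dc by simp
  also have "\<dots> = (D * A) * C" using Dc A C by (metis assoc_mult_mat)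
  also have "\<dots> = C" using DA C by simp
  finally show "D = C" .
qed

lemma mat_inv_det_unit:
  fixes A :: "'a::comm_ring_1 mat"
  assumes A: "A \<in> carrier_mat n n" and u: "u * det A = 1"
  shows "mat_inv A = u \<cdot>\<^sub>m adj_mat A"
proof (rule mat_inv_eqI[OF A])
  note adj = adj_mat[OF A]
  show "u \<cdot>\<^sub>m adj_mat A \<in> carrier_mat n n" using adj(1) by simp
  have s: "u \<cdot>\<^sub>m (det A \<cdot>\<^sub>m 1\<^sub>m n) = 1\<^sub>m n"
    using u by (intro eq_matI) auto
  show "A * (u \<cdot>\<^sub>m adj_mat A) = 1\<^sub>m n"
    using mult_smult_distrib[OF A adj(1)] adj(2) s by simp
  show "(u \<cdot>\<^sub>m adj_mat A) * A = 1\<^sub>m n"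
    using mult_smult_assoc_mat[OF adj(1) A] adj(3) s by simp
qed

lemma mat_inv_invertible:
  fixes A :: "'a::field mat"
  assumes A: "A \<in> carrier_mat n n" and inv: "invertible_mat A"
  shows "mat_inv A \<in> carrier_mat n n" "A * mat_inv A = 1\<^sub>m n" "mat_inv A * A = 1\<^sub>m n"
proof -
  from inv obtain C where C: "inverts_mat A C" "inverts_mat C A"
    unfolding invertible_mat_def by blast
  have AC: "A * C = 1\<^sub>m n" using C(1) A by (auto simp: inverts_mat_def)
  have "dim_col C = n" using arg_cong[OF AC, of dim_col] by simp
  moreover have "dim_row C = n"
  proof -
    have "dim_col (C * A) = dim_col (1\<^sub>m (dim_row C) :: 'a mat)"
      using C(2) unfolding inverts_mat_def by (rule arg_cong)
    then show ?thesis using A by simp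
  qed
  ultimately have Cc: "C \<in> carrier_mat n n" by auto
  have CA: "C * A = 1\<^sub>m n" using C(2) Cc by (auto simp: inverts_mat_def)
  from mat_inv_eqI[OF A Cc AC CA] Cc AC CA
  show "mat_inv A \<in> carrier_mat n n" "A * mat_inv A = 1\<^sub>m n" "mat_inv A * A = 1\<^sub>m n"
    by auto
qed

lemma (in network_code) K_strict_upper:
  assumes "i < length es" "j < length es" "j \<le> i"
  shows "K $$ (i, j) = 0"
proof (rule ccontr)
  assume "K $$ (i, j) \<noteq> 0"
  then have eq: "head G (es ! i) = tail G (es ! j)" using K_supp assms by blast
  have "es ! i \<in> arcs G" using edge_order assms(1) by (auto simp: ancestral_order_def)
  then have "head G (es ! i) \<rightarrow>\<^sup>*\<^bsub>G\<^esub> tail G (es ! j)"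
    using eq by (metis head_in_verts reachable_refl)
  then have "i < j" using edge_order assms by (auto simp: ancestral_order_def)
  then show False using assms by simp
qed

lemma (in network_code) mat_inv_transfer:
  fixes c :: "'b::comm_ring_1" and f :: "'a \<Rightarrow> 'b"
  assumes f0: "f 0 = 0"
  defines "N \<equiv> 1\<^sub>m (dim_row K) - c \<cdot>\<^sub>m map_mat f K"
  shows "mat_inv N = adj_mat N" "N * mat_inv N = 1\<^sub>m (length es)" "mat_inv N * N = 1\<^sub>m (length es)"
proof -
  have N: "N \<in> carrier_mat (length es) (length es)" using K_dim by (auto simp: N_def)
  have "upper_triangular N"
    unfolding upper_triangular_def using K_dim K_strict_upper by (auto simp: N_def f0)
  moreover have "diag_mat N = map (\<lambda>_. 1) [0..<length es]"
    using K_dim K_strict_upper by (auto simp: N_def diag_mat_def f0)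
  moreover have "prod_list (map (\<lambda>_. 1::'b) xs) = 1" for xs :: "nat list" by (induction xs) auto
  ultimately have det: "det N = 1" using det_upper_triangular[OF _ N] by simp
  have one: "1 \<cdot>\<^sub>m X = X" for X :: "'b mat" by (intro eq_matI) auto
  show *: "mat_inv N = adj_mat N"
    using mat_inv_det_unit[OF N, of 1] det by (simp add: one)
  show "N * mat_inv N = 1\<^sub>m (length es)" "mat_inv N * N = 1\<^sub>m (length es)"
    using adj_mat[OF N] det * by (simp_all add: one)
qed

lemma processing_matrix:
  fixes M :: "'a::field poly mat"
  assumes M: "M \<in> carrier_mat n n" and det: "det M \<noteq> 0"
    and g: "is_gcd_of g (elements_mat (adj_mat M))"
  shows "processing_matrix M g = map_mat (\<lambda>x. x div g) (adj_mat M)"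
    and "map_mat to_fract (processing_matrix M g) =
      to_fract (processing_function M g) \<cdot>\<^sub>m mat_inv (map_mat to_fract M)"
proof -
  note adj = adj_mat[OF M]
  interpret h: comm_ring_hom "to_fract :: 'a poly \<Rightarrow> 'a poly fract"
    by unfold_locales auto
  let ?M = "map_mat to_fract M" and ?d = "to_fract (det M)"
  let ?Q = "map_mat (\<lambda>x. x div g) (adj_mat M)"
  have Mc: "?M \<in> carrier_mat n n" using M by simp
  have dM: "det ?M = ?d" by (simp add: h.hom_det)
  have ne: "?d \<noteq> 0" using det by simp
  have adjM: "adj_mat ?M = map_mat to_fract (adj_mat M)"
  proof -
    have "map_mat to_fract (mat_delete M j i) = mat_delete ?M j i" if "i < n" "j < n" for i j
      using that M by (intro eq_matI) (auto simp: mat_delete_def)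
    then have "det (mat_delete ?M j i) = to_fract (det (mat_delete M j i))"
      if "i < n" "j < n" for i j using that by (metis h.hom_det)
    then show ?thesis using M
      by (intro eq_matI) (auto simp: adj_mat_def cofactor_def h.hom_mult h.hom_power)
  qed
  have inv: "mat_inv ?M = (1 / ?d) \<cdot>\<^sub>m map_mat to_fract (adj_mat M)"
    using mat_inv_det_unit[OF Mc, of "1 / ?d"] ne by (simp add: dM adjM)
  have entry: "g dvd adj_mat M $$ (i, j)" if "i < n" "j < n" for i j
    using g that adj(1) unfolding is_gcd_of_def by (meson elements_matI)
  have Q: "map_mat to_fract ?Q = to_fract (processing_function M g) \<cdot>\<^sub>m mat_inv ?M"
  proof (rule eq_matI)
    fix i j
    assume "i < dim_row (to_fract (processing_function M g) \<cdot>\<^sub>m mat_inv ?M)"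
      "j < dim_col (to_fract (processing_function M g) \<cdot>\<^sub>m mat_inv ?M)"
    then have ij: "i < n" "j < n" using adj(1) by (auto simp: inv)
    have "g dvd (M * adj_mat M) $$ (i, i)"
      using ij M adj(1) entry by (auto simp: scalar_prod_def intro!: dvd_sum dvd_mult)
    then have gd: "g dvd det M" using ij adj(2) by simp
    have g0: "g \<noteq> 0" using gd det by auto
    obtain x where x: "adj_mat M $$ (i, j) = g * x" using entry[OF ij] by (auto elim: dvdE)
    obtain y where y: "det M = g * y" using gd by (auto elim: dvdE)
    have y0: "y \<noteq> 0" using y det by auto
    show "map_mat to_fract ?Q $$ (i, j) =
      (to_fract (processing_function M g) \<cdot>\<^sub>m mat_inv ?M) $$ (i, j)"
      using ij adj(1) g0 y0 by (simp add: inv processing_function_def x y h.hom_mult)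
  qed (use adj(1) in \<open>auto simp: inv\<close>)
  show eq: "processing_matrix M g = ?Q"
    unfolding processing_matrix_def
  proof (rule the_equality)
    fix P assume "map_mat to_fract P =
      to_fract (processing_function M g) \<cdot>\<^sub>m mat_inv ?M"
    then have *: "map_mat to_fract P = map_mat to_fract ?Q" using Q by simp
    have d: "dim_row P = dim_row ?Q" "dim_col P = dim_col ?Q"
      using arg_cong[OF *, of dim_row] arg_cong[OF *, of dim_col] by simp_all
    show "P = ?Q"
    proof (rule eq_matI)
      fix i j assume ij: "i < dim_row ?Q" "j < dim_col ?Q"
      have "map_mat to_fract P $$ (i, j) = map_mat to_fract ?Q $$ (i, j)" using * by simp
      then show "P $$ (i, j) = ?Q $$ (i, j)" using ij d by simp
    qed (use d in auto)
  qed (rule Q)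
  show "map_mat to_fract (processing_matrix M g) =
      to_fract (processing_function M g) \<cdot>\<^sub>m mat_inv ?M"
    using Q eq by simp
qed

end

theory Submission
  imports Defs
begin

text \<open>Evaluation at \<open>z = 1\<close> is a ring homomorphism that takes the transfer matrices of the
  unit-delay network to those of the instantaneous one, and \<open>g(z) P(z)\<close> to
  \<open>det M \<cdot> M\<^sup>-\<^sup>1\<close>. Hence a nonzero entry of \<open>w F M\<^sup>-\<^sup>1\<close> forces the corresponding polynomial
  entry of \<open>w F(z) P(z)\<close> not to vanish at \<open>1\<close>, so that it has a nonzero coefficient.\<close>

abbreviation eval_one_mat :: "'a::comm_ring_1 poly mat \<Rightarrow> 'a mat" where
  "eval_one_mat \<equiv> map_mat (\<lambda>p. poly p 1)"

lemma comm_ring_hom_eval_one: "comm_ring_hom (\<lambda>p :: 'a::comm_ring_1 poly. poly p 1)"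
  by unfold_locales auto

lemma eval_one_mat_mult:
  fixes X Y :: "'a::comm_ring_1 poly mat"
  assumes "X \<in> carrier_mat m k" "Y \<in> carrier_mat k l"
  shows "eval_one_mat (X * Y) = eval_one_mat X * eval_one_mat Y"
proof -
  interpret h: comm_ring_hom "\<lambda>p :: 'a poly. poly p 1" by (rule comm_ring_hom_eval_one)
  show ?thesis using h.mat_hom_mult[OF assms] .
qed

lemma eval_one_const_mat: "eval_one_mat (const_mat X) = X"
  by (intro eq_matI) (auto simp: const_mat_def)

lemma eval_one_mat_one: "eval_one_mat (1\<^sub>m m) = 1\<^sub>m m"
  by (intro eq_matI) auto

text \<open>The error vector has constant entries, which evaluation leaves alone, so evaluating an
  output entry at 1 affects only the matrix.\<close>

lemma poly_row_mult_const_vec: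
  fixes X :: "'a::comm_ring_1 poly mat"
  assumes "j < dim_col X" "dim_vec w = dim_row X"
  shows "poly (row_mult (map_vec (\<lambda>a. [:a:]) w) X $ j) 1 = row_mult w (eval_one_mat X) $ j"
  using assms by (simp add: row_mult_def scalar_prod_def poly_sum)

lemma row_mult_smult:
  fixes X :: "'a::comm_ring_1 mat"
  assumes "j < dim_col X" "dim_vec w = dim_row X"
  shows "row_mult w (c \<cdot>\<^sub>m X) $ j = c * row_mult w X $ j"
  using assms by (simp add: row_mult_def scalar_prod_def sum_distrib_left algebra_simps)

text \<open>Each nonzero \<open>v $ i\<close> counts once on the left, while the nonzero polynomial
  \<open>u $ i\<close> contributes at least its leading coefficient on the right.\<close>

lemma hamming_weight_le_poly_hamming_weight:
  assumes dim: "dim_vec v = dim_vec u"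
    and nz: "\<And>i. i < dim_vec v \<Longrightarrow> v $ i \<noteq> 0 \<Longrightarrow> u $ i \<noteq> 0"
  shows "hamming_weight v \<le> poly_hamming_weight u"
proof -
  have "hamming_weight v = (\<Sum>i<dim_vec v. if v $ i \<noteq> 0 then 1 else 0)"
    unfolding hamming_weight_def by (simp add: sum.If_cases Int_def)
  also have "\<dots> \<le> (\<Sum>i<dim_vec v. card {k. coeff (u $ i) k \<noteq> 0})"
  proof (rule sum_mono)
    fix i assume i: "i \<in> {..<dim_vec v}"
    \<comment> \<open>On an infinite set \<open>card\<close> would take the default value 0, so
      nonemptiness alone would not give a positive count.\<close>
    have fin: "finite {k. coeff (u $ i) k \<noteq> 0}"
      using MOST_coeff_eq_0[of "u $ i"] by (simp add: eventually_cofinite)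
    show "(if v $ i \<noteq> 0 then 1 else 0) \<le> card {k. coeff (u $ i) k \<noteq> 0}"
    proof (cases "v $ i = 0")
      case False
      then have "coeff (u $ i) (degree (u $ i)) \<noteq> 0" using nz i by simp
      then have "{k. coeff (u $ i) k \<noteq> 0} \<noteq> {}" by blast
      then show ?thesis using fin by (simp add: Suc_le_eq card_gt_0_iff)
    qed simp
  qed
  finally show ?thesis using dim by (simp add: poly_hamming_weight_def)
qed

text \<open>This makes the \<open>Max\<close> in \<open>t_inst\<close> and \<open>t_delay\<close>
  range over finite sets: the vectors have fixed length over a finite alphabet.\<close>

lemma finite_error_vectors: "finite (error_vectors es \<Phi> :: 'a::{zero,finite} vec set)"
proof (rule finite_subset)
  show "(error_vectors es \<Phi> :: 'a vec set) \<subseteq> vec_of_list ` {xs. set xs \<subseteq> UNIV \<and> length xs = length es}"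
  proof
    fix w :: "'a vec" assume "w \<in> error_vectors es \<Phi>"
    then have "length (list_of_vec w) = length es" by (auto simp: error_vectors_def)
    then show "w \<in> vec_of_list ` {xs. set xs \<subseteq> UNIV \<and> length xs = length es}"
      by (intro image_eqI[of _ _ "list_of_vec w"]) (auto simp: vec_list)
  qed
qed (intro finite_imageI finite_lists_length_eq finite_UNIV)

context network_code
begin

text \<open>Evaluating both identities for the polynomial inverse of \<open>N\<close> at 1 yields a
  two-sided inverse of \<open>I - K\<close>, and such an inverse is unique.\<close>

lemma transfer_inverses:
  defines "N \<equiv> 1\<^sub>m (dim_row K) - monom 1 1 \<cdot>\<^sub>m const_mat K"
  shows "mat_inv N \<in> carrier_mat (length es) (length es)"
    and "mat_inv (1\<^sub>m (dim_row K) - K) = eval_one_mat (mat_inv N)"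
proof -
  have N: "N \<in> carrier_mat (length es) (length es)"
    using K_dim by (auto simp: N_def const_mat_def)
  have inv: "mat_inv N = adj_mat N" "N * mat_inv N = 1\<^sub>m (length es)"
    "mat_inv N * N = 1\<^sub>m (length es)"
    \<comment> \<open>Ancestral order makes \<open>K\<close> strictly upper triangular, so
      \<open>det N = 1\<close> and the inverse already exists over polynomials, as the
      adjugate.\<close>
    using mat_inv_transfer[of "\<lambda>a. [:a:]" "monom 1 1"] by (simp_all add: N_def const_mat_def)
  show Ninv: "mat_inv N \<in> carrier_mat (length es) (length es)"
    using inv(1) adj_mat(1)[OF N] by simp
  have eN: "eval_one_mat N = 1\<^sub>m (dim_row K) - K"
    using K_dim by (intro eq_matI) (auto simp: N_def const_mat_def poly_monom)
  show "mat_inv (1\<^sub>m (dim_row K) - K) = eval_one_mat (mat_inv N)"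
  proof (rule mat_inv_eqI)
    show "(1\<^sub>m (dim_row K) - K) * eval_one_mat (mat_inv N) = 1\<^sub>m (length es)"
      using eval_one_mat_mult[OF N Ninv] inv(2) by (simp add: eN eval_one_mat_one)
    show "eval_one_mat (mat_inv N) * (1\<^sub>m (dim_row K) - K) = 1\<^sub>m (length es)"
      using eval_one_mat_mult[OF Ninv N] inv(3) by (simp add: eN eval_one_mat_one)
  qed (use K_dim Ninv in auto)
qed

lemma F_delay_eval_one:
  assumes "T \<in> sinks"
  shows "F_delay K (B T) \<in> carrier_mat (length es) n"
    and "eval_one_mat (F_delay K (B T)) = F_inst K (B T)"
proof -
  have BT: "const_mat (B T) \<in> carrier_mat (length es) n"
    using B_dim[OF assms] by (auto simp: const_mat_def)
  show "F_delay K (B T) \<in> carrier_mat (length es) n"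
    unfolding F_delay_def using transfer_inverses(1) BT by simp
  show "eval_one_mat (F_delay K (B T)) = F_inst K (B T)"
    unfolding F_delay_def F_inst_def
    using eval_one_mat_mult[OF transfer_inverses(1) BT]
    by (simp add: transfer_inverses(2) eval_one_const_mat)
qed

lemma M_delay_eval_one:
  assumes "T \<in> sinks"
  shows "M_delay A K (B T) \<in> carrier_mat n n"
    and "eval_one_mat (M_delay A K (B T)) = M_inst A K (B T)"
proof -
  note F = F_delay_eval_one[OF assms]
  have A: "const_mat A \<in> carrier_mat n (length es)" using A_dim by (auto simp: const_mat_def)
  show "M_delay A K (B T) \<in> carrier_mat n n" unfolding M_delay_def using A F(1) by simp
  show "eval_one_mat (M_delay A K (B T)) = M_inst A K (B T)"
    unfolding M_delay_def M_inst_def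
    using eval_one_mat_mult[OF A F(1)] by (simp add: F(2) eval_one_const_mat)
qed

text \<open>Since \<open>P\<close> is the adjugate of \<open>M(z)\<close> divided entrywise by
  \<open>g\<close>, the product \<open>g P\<close> is that adjugate, and the adjugate identity can
  be evaluated at 1. Keeping the factors \<open>det\<close> and \<open>poly g 1\<close> on the two
  sides avoids dividing by \<open>poly g 1\<close>.\<close>

lemma processing_matrix_eval_one:
  assumes T: "T \<in> sinks" and inv: "invertible_mat (M_inst A K (B T))"
    and g: "is_gcd_of g (elements_mat (adj_mat (M_delay A K (B T))))"
  defines "P \<equiv> processing_matrix (M_delay A K (B T)) g"
  shows "P \<in> carrier_mat n n" and "det (M_inst A K (B T)) \<noteq> 0"
    and "det (M_inst A K (B T)) \<cdot>\<^sub>m mat_inv (M_inst A K (B T)) = poly g 1 \<cdot>\<^sub>m eval_one_mat P"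
proof -
  interpret h: comm_ring_hom "\<lambda>p :: 'a poly. poly p 1" by (rule comm_ring_hom_eval_one)
  let ?M = "M_delay A K (B T)" and ?M1 = "M_inst A K (B T)"
  note M = M_delay_eval_one[OF T]
  note adj = adj_mat[OF M(1)]
  have M1: "?M1 \<in> carrier_mat n n" using M by (metis map_carrier_mat)
  note mi = mat_inv_invertible[OF M1 inv]
  have "det ?M1 * det (mat_inv ?M1) = 1" using det_mult[OF M1 mi(1)] mi(2) by simp
  then show d1: "det ?M1 \<noteq> 0" by auto
  \<comment> \<open>Invertibility at 1 forces \<open>det M(z)\<close> to be a nonzero polynomial, as
    the closed form of the processing matrix requires.\<close>
  have dM: "poly (det ?M) 1 = det ?M1" using h.hom_det[of ?M] M(2) by simp
  then have "det ?M \<noteq> 0" using d1 by auto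
  then have P: "P = map_mat (\<lambda>x. x div g) (adj_mat ?M)"
    unfolding P_def using processing_matrix(1)[OF M(1) _ g] by simp
  then show Pc: "P \<in> carrier_mat n n" using adj(1) by simp
  \<comment> \<open>Divisibility makes the entrywise \<open>div\<close> exact, so multiplying back
    by \<open>g\<close> recovers the adjugate.\<close>
  have "g dvd adj_mat ?M $$ (i, j)" if "i < n" "j < n" for i j
    using g that adj(1) unfolding is_gcd_of_def by (meson elements_matI)
  then have gP: "adj_mat ?M = g \<cdot>\<^sub>m P"
    using adj(1) by (intro eq_matI) (auto simp: P)
  have e_gP: "eval_one_mat (adj_mat ?M) = poly g 1 \<cdot>\<^sub>m eval_one_mat P"
    unfolding gP by (intro eq_matI) auto
  have "?M1 * (poly g 1 \<cdot>\<^sub>m eval_one_mat P) = eval_one_mat (?M * adj_mat ?M)"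
    using eval_one_mat_mult[OF M(1) adj(1)] M(2) e_gP by simp
  also have "\<dots> = det ?M1 \<cdot>\<^sub>m 1\<^sub>m n"
    unfolding adj(2) by (intro eq_matI) (auto simp: dM)
  finally have prod: "?M1 * (poly g 1 \<cdot>\<^sub>m eval_one_mat P) = det ?M1 \<cdot>\<^sub>m 1\<^sub>m n" .
  have gPc: "poly g 1 \<cdot>\<^sub>m eval_one_mat P \<in> carrier_mat n n" using Pc by simp
  \<comment> \<open>Multiplying \<open>prod\<close> on the left by the inverse cancels
    \<open>?M1\<close>.\<close>
  have "det ?M1 \<cdot>\<^sub>m mat_inv ?M1 = mat_inv ?M1 * (det ?M1 \<cdot>\<^sub>m 1\<^sub>m n)"
    using mult_smult_distrib[OF mi(1), of "1\<^sub>m n" n "det ?M1"] mi(1) by simp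
  also have "\<dots> = (mat_inv ?M1 * ?M1) * (poly g 1 \<cdot>\<^sub>m eval_one_mat P)"
    using assoc_mult_mat[OF mi(1) M1 gPc] prod by simp
  also have "\<dots> = poly g 1 \<cdot>\<^sub>m eval_one_mat P" using mi(3) left_mult_one_mat[OF gPc] by simp
  finally show "det ?M1 \<cdot>\<^sub>m mat_inv ?M1 = poly g 1 \<cdot>\<^sub>m eval_one_mat P" .
qed

lemma inst_error_weight_le_delay_error_weight:
  assumes T: "T \<in> sinks" and inv: "invertible_mat (M_inst A K (B T))"
    and g: "is_gcd_of g (elements_mat (adj_mat (M_delay A K (B T))))"
    and w: "w \<in> carrier_vec (length es)"
  shows "inst_error_weight A K (B T) w \<le> delay_error_weight A K (B T) g w"
proof -
  define P where "P = processing_matrix (M_delay A K (B T)) g"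
  define d where "d = det (M_inst A K (B T))"
  let ?F = "F_delay K (B T)" and ?F1 = "F_inst K (B T)" and ?I = "mat_inv (M_inst A K (B T))"
  note F = F_delay_eval_one[OF T]
  note PM = processing_matrix_eval_one[OF T inv g, folded P_def d_def]
  have F1: "?F1 \<in> carrier_mat (length es) n" using F by (metis map_carrier_mat)
  have "M_inst A K (B T) \<in> carrier_mat n n"
    using M_delay_eval_one[OF T] by (metis map_carrier_mat)
  then have I: "?I \<in> carrier_mat n n" using mat_inv_invertible(1) inv by blast
  have P1: "eval_one_mat P \<in> carrier_mat n n" using PM(1) by simp
  \<comment> \<open>The scalar identity for \<open>P\<close> is multiplied on the left by
    \<open>?F1\<close>, which is the value of \<open>?F\<close> at 1.\<close>
  have mat: "d \<cdot>\<^sub>m (?F1 * ?I) = poly g 1 \<cdot>\<^sub>m eval_one_mat (?F * P)"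
    using mult_smult_distrib[OF F1 I, of d] mult_smult_distrib[OF F1 P1, of "poly g 1"]
      eval_one_mat_mult[OF F(1) PM(1)] F(2) PM(3) by simp
  show ?thesis
    unfolding inst_error_weight_def delay_error_weight_def P_def[symmetric]
  proof (rule hamming_weight_le_poly_hamming_weight)
    show "dim_vec (row_mult w (?F1 * ?I)) = dim_vec (row_mult (map_vec (\<lambda>a. [:a:]) w) (?F * P))"
      using I PM(1) by (simp add: row_mult_def)
  next
    fix j assume "j < dim_vec (row_mult w (?F1 * ?I))" and nz: "row_mult w (?F1 * ?I) $ j \<noteq> 0"
    then have j: "j < n" using I by (simp add: row_mult_def)
    have "d * row_mult w (?F1 * ?I) $ j = row_mult w (d \<cdot>\<^sub>m (?F1 * ?I)) $ j"
      using j w F1 I by (intro row_mult_smult[symmetric]) auto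
    also have "\<dots> = poly g 1 * row_mult w (eval_one_mat (?F * P)) $ j"
      unfolding mat using j w F(1) PM(1) by (intro row_mult_smult) auto
    also have "row_mult w (eval_one_mat (?F * P)) $ j =
        poly (row_mult (map_vec (\<lambda>a. [:a:]) w) (?F * P) $ j) 1"
      using j w F(1) PM(1) by (intro poly_row_mult_const_vec[symmetric]) auto
    \<comment> \<open>The left side of the chain is nonzero because \<open>d\<close> and the
      instantaneous entry are. Hence the polynomial entry has a nonzero value at 1.\<close>
    finally show "row_mult (map_vec (\<lambda>a. [:a:]) w) (?F * P) $ j \<noteq> 0"
      using nz PM(2) by auto
  qed
qed

lemma t_inst_le_t_delay:
  assumes le: "\<And>T w. T \<in> sinks \<Longrightarrow> w \<in> carrier_vec (length es) \<Longrightarrow>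
      inst_error_weight A K (B T) w \<le> delay_error_weight A K (B T) (g T) w"
  shows "t_inst sinks es A K B \<Phi> \<le> t_delay sinks es A K B g \<Phi>"
proof -
  \<comment> \<open>Indexing both maxima by the same pairs reduces their comparison to a pointwise
    one.\<close>
  define S where "S = sinks \<times> (error_vectors es \<Phi> :: 'a vec set)"
  let ?i = "\<lambda>(T, w). inst_error_weight A K (B T) w"
  let ?d = "\<lambda>(T, w). delay_error_weight A K (B T) (g T) w"
  have t: "t_inst sinks es A K B \<Phi> = Max (?i ` S)" "t_delay sinks es A K B g \<Phi> = Max (?d ` S)"
    unfolding t_inst_def t_delay_def S_def by (auto intro!: arg_cong[of _ _ Max])
  have fin: "finite S"
    unfolding S_def using finite_subset[OF sinks] by (simp add: finite_error_vectors)
  show ?thesis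
  proof (cases "S = {}")
    case False
    have "?i x \<le> Max (?d ` S)" if "x \<in> S" for x
    proof -
      have "?i x \<le> ?d x" using that le by (auto simp: S_def error_vectors_def)
      also have "\<dots> \<le> Max (?d ` S)" using that fin by simp
      finally show ?thesis .
    qed
    then show ?thesis unfolding t using fin False by simp
  \<comment> \<open>If \<open>S\<close> is empty, both sides are the same unspecified value
    \<open>Max {}\<close>.\<close>
  qed (simp add: t)
qed

end

theorem mainTheorem5:
  fixes G :: "('v, 'e) pre_digraph" and s :: 'v and sinks :: "'v set" and es :: "'e list"
    and n :: nat and A K :: "'a::{field,finite} mat" and B :: "'v \<Rightarrow> 'a mat"
    and g :: "'v \<Rightarrow> 'a poly"
  assumes "network_code G s sinks es n A K B"
    and "\<And>T. T \<in> sinks \<Longrightarrow> invertible_mat (M_inst A K (B T))"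
    and "\<And>T. T \<in> sinks \<Longrightarrow> is_gcd_of (g T) (elements_mat (adj_mat (M_delay A K (B T))))"
  shows "(\<forall>T\<in>sinks. \<forall>w\<in>carrier_vec (length es).
            inst_error_weight A K (B T) w \<le> delay_error_weight A K (B T) (g T) w)
       \<and> (\<forall>\<Phi>. \<Phi> \<subseteq> Pow (arcs G) \<longrightarrow>
            demanded_free_distance (t_delay sinks es A K B g \<Phi>)
            \<ge> demanded_free_distance (t_inst sinks es A K B \<Phi>))"
proof -
  interpret network_code G s sinks es n A K B by (rule assms(1))
  have le: "inst_error_weight A K (B T) w \<le> delay_error_weight A K (B T) (g T) w"
    if "T \<in> sinks" "w \<in> carrier_vec (length es)" for T w
    using inst_error_weight_le_delay_error_weight that assms(2,3) by blast
  then have "t_inst sinks es A K B \<Phi> \<le> t_delay sinks es A K B g \<Phi>" for \<Phi>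
    by (rule t_inst_le_t_delay)
  with le show ?thesis by (simp add: demanded_free_distance_def)
qed

end
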